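(* Let $t \geq 3$ be an integer, let $V$ be a finite set with $|V| = n$, and suppose that $\mathcal G_1, \ldots, \mathcal G_t \subset \binom{V}{2}$ are rainbow triangle-free (RBT-free). Then (i) or (ii) holds: (i) $t = 3$ and $|\mathcal G_1| + |\mathcal G_2| + |\mathcal G_3| \leq n(n-1)$; (ii) $t \geq 4$ and $|\mathcal G_1| + \ldots + |\mathcal G_t| \leq t \lfloor n^2/4 \rfloor$.
   Context: A graph on the vertex set $V$ is identified with its edge set, a subset of $\binom{V}{2}$ (the 2-element subsets of $V$), and $|\mathcal G|$ denotes the number of edges. A triangle is the set of three edges $\binom{T}{2}$ for some 3-element set $T \subset V$. Graphs $\mathcal G_1, \ldots, \mathcal G_t \subset \binom{V}{2}$ (not necessarily distinct or disjoint) are called rainbow triangle-free (RBT-free) if there do not exist indices $1 \leq i_1 < i_2 < i_3 \leq t$ and edges $E_1 \in \mathcal G_{i_1}$, $E_2 \in \mathcal G_{i_2}$, $E_3 \in \mathcal G_{i_3}$ such that $\{E_1, E_2, E_3\}$ is a triangle.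
   Formalization: The case t = 3, n = 2 is excluded, because there the claim fails: taking all three graphs equal to the single edge gives an RBT-free family with 3 edges in total, while n(n-1) = 2. *)

theory Defs
  imports Complex_Main "HOL-Library.Ramsey"
begin

text \<open>
  A graph on \<open>V\<close> is its edge set, a subset of \<open>[V]\<^bsup>2\<^esup>\<close> (the set of 2-element subsets of \<open>V\<close>).
\<close>

definition is_triangle :: "'a set \<Rightarrow> 'a set set \<Rightarrow> bool" where
  "is_triangle V S \<longleftrightarrow> (\<exists>T \<in> [V]\<^bsup>3\<^esup>. S = [T]\<^bsup>2\<^esup>)"

text \<open>
  A family \<open>\<G>\<^sub>1, \<dots>, \<G>\<^sub>t\<close> is a function on \<open>nat\<close> of which only the values at \<open>1, \<dots>, t\<close> matter;
  the graphs may coincide or overlap.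
\<close>

definition rainbow_triangle_free :: "'a set \<Rightarrow> nat \<Rightarrow> (nat \<Rightarrow> 'a set set) \<Rightarrow> bool" where
  "rainbow_triangle_free V t G \<longleftrightarrow>
     \<not> (\<exists>i1 i2 i3 E1 E2 E3. 1 \<le> i1 \<and> i1 < i2 \<and> i2 < i3 \<and> i3 \<le> t \<and>
          E1 \<in> G i1 \<and> E2 \<in> G i2 \<and> E3 \<in> G i3 \<and> is_triangle V {E1, E2, E3})"

text \<open>
  With \<open>t = 3\<close> and two vertices, taking the single edge three times gives a rainbow triangle-free
  family with \<open>3 > n (n - 1) = 2\<close> edges in total. This one case has to be excluded from the bound.
\<close>

lemma two_vertices_exceed_bound:
  fixes V :: "'a set" and G :: "nat \<Rightarrow> 'a set set"
  assumes "card V = 2" and "\<And>i. G i = [V]\<^bsup>2\<^esup>"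
  shows "rainbow_triangle_free V 3 G"
    and "card (G 1) + card (G 2) + card (G 3) = 3"
proof -
  obtain x y where V: "V = {x, y}" "x \<noteq> y"
    using assms(1) by (auto simp: card_2_iff)
  have "card T \<noteq> 3" if "T \<subseteq> V" for T
    using card_mono[OF _ that] V by simp
  then have "[V]\<^bsup>3\<^esup> = {}"
    by (auto simp: nsets_def)
  then show "rainbow_triangle_free V 3 G"
    by (simp add: rainbow_triangle_free_def is_triangle_def)
  show "card (G 1) + card (G 2) + card (G 3) = 3"
    by (simp add: assms(2) V)
qed

end

theory Submission
  imports Defs
begin

text \<open>
  Give each pair \<open>e\<close> the set \<open>c e\<close> of the indices of the graphs containing it, so that the number
  of edges is the sum of all \<open>card (c e)\<close>. If no pair carries more than two colours, this sum is at
  most \<open>n (n - 1)\<close>. Otherwise let \<open>{u, v}\<close> carry at least three colours. For every other vertex \<open>w\<close>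
  the pairs \<open>{u, w}\<close> and \<open>{v, w}\<close> cannot have distinct colours \<open>i \<noteq> j\<close>, since a third colour of
  \<open>{u, v}\<close> would complete a rainbow triangle; so together they carry at most \<open>t\<close> colours. Hence
  deleting \<open>u\<close> and \<open>v\<close> removes at most \<open>t (n - 1)\<close> edges, and one concludes by induction on \<open>n\<close>.
\<close>

lemma sum_nsets_2_insert:
  assumes "finite A" and "x \<notin> A"
  shows "sum g ([insert x A]\<^bsup>2\<^esup>) = sum g ([A]\<^bsup>2\<^esup>) + (\<Sum>y\<in>A. g {x, y})"
proof -
  have eq: "[insert x A]\<^bsup>2\<^esup> = [A]\<^bsup>2\<^esup> \<union> (\<lambda>y. {x, y}) ` A"
    using assms(2) by (auto simp: nsets_def card_2_iff doubleton_eq_iff)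
  have "inj_on (\<lambda>y. {x, y}) A"
    by (auto simp: inj_on_def doubleton_eq_iff)
  moreover have "[A]\<^bsup>2\<^esup> \<inter> (\<lambda>y. {x, y}) ` A = {}"
    using assms(2) by (auto simp: nsets_def)
  ultimately show ?thesis
    unfolding eq using assms(1) by (simp add: sum.union_disjoint sum.reindex finite_imp_finite_nsets)
qed

text \<open>If both sets are nonempty, they are the same singleton and the sum is 2, which
  \<open>card K\<close> covers. In the induction, \<open>A\<close> and \<open>B\<close> are the
  colour sets of the two pairs joining a vertex to \<open>u\<close> and \<open>v\<close>.\<close>

lemma card_add_card_le_if_no_distinct_pair:
  assumes "finite K" and "2 \<le> card K" and "A \<subseteq> K" and "B \<subseteq> K"
    and "\<And>i j. i \<in> A \<Longrightarrow> j \<in> B \<Longrightarrow> i = j"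
  shows "card A + card B \<le> card K"
proof (cases "A = {} \<or> B = {}")
  case True
  then show ?thesis
    using card_mono[OF assms(1)] assms(3,4) by auto
next
  case False
  then obtain a where "A = {a}" "B = {a}"
    using assms(5) by blast
  then show ?thesis
    using assms(2) by simp
qed

lemma ex_third_element:
  assumes "3 \<le> card C"
  shows "\<exists>k\<in>C. k \<noteq> i \<and> k \<noteq> j"
proof (rule ccontr)
  assume "\<not> ?thesis"
  then have "C \<subseteq> {i, j}"
    by auto
  then have "card C \<le> card {i, j}"
    by (intro card_mono) auto
  also have "\<dots> \<le> 2"
    by (simp add: card_insert_if)
  finally show False
    using assms by simp
qed

text \<open>The bound \<open>f\<close> stays abstract so that one induction serves both
  \<open>t = 3\<close> and \<open>t \<ge> 4\<close>: \<open>f_ge\<close> settles the case of at most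
  two colours per pair, \<open>f_step\<close> pays for deleting two vertices.\<close>

lemma sum_card_colours_le:
  fixes c :: "'a set \<Rightarrow> 'b set" and f :: "nat \<Rightarrow> nat"
  assumes "finite K" and "2 \<le> card K" and cK: "\<And>e. c e \<subseteq> K"
    and f_ge: "\<And>n. n * (n - 1) \<le> f n"
    and f_step: "\<And>n. f n + card K * (n + 1) \<le> f (n + 2)"
    and "finite V"
    and no_rainbow: "\<And>x y z i j k. \<lbrakk>{x, y, z} \<subseteq> V; x \<noteq> y; x \<noteq> z; y \<noteq> z;
           i \<in> c {x, z}; j \<in> c {y, z}; k \<in> c {x, y}; i \<noteq> j; k \<noteq> i; k \<noteq> j\<rbrakk> \<Longrightarrow> False"
  shows "(\<Sum>e\<in>[V]\<^bsup>2\<^esup>. card (c e)) \<le> f (card V)"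
  using \<open>finite V\<close> no_rainbow
proof (induction "card V" arbitrary: V rule: less_induct)
  case less
  show ?case
  proof (cases "\<forall>e\<in>[V]\<^bsup>2\<^esup>. card (c e) \<le> 2")
    case True
    then have "(\<Sum>e\<in>[V]\<^bsup>2\<^esup>. card (c e)) \<le> card ([V]\<^bsup>2\<^esup>) * 2"
      using sum_bounded_above[of "[V]\<^bsup>2\<^esup>" "\<lambda>e. card (c e)" 2] by simp
    also have "\<dots> = card V * (card V - 1)"
      by (cases "card V") (simp_all add: choose_two)
    finally show ?thesis
      using f_ge[of "card V"] by linarith
  next
    case False
    then obtain e where "e \<in> [V]\<^bsup>2\<^esup>" and e3: "3 \<le> card (c e)"
      by auto
    then obtain u v where uv: "e = {u, v}" "u \<noteq> v" "u \<in> V" "v \<in> V"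
      by (auto simp: nsets_def card_2_iff)
    define W where "W = V - {u, v}"
    have W: "finite W" "u \<notin> insert v W" "v \<notin> W" and V: "V = insert u (insert v W)"
      using less.prems(1) uv by (auto simp: W_def)
    have card_V: "card V = card W + 2"
      using W V by simp
    have IH: "(\<Sum>e\<in>[W]\<^bsup>2\<^esup>. card (c e)) \<le> f (card W)"
    proof (rule less.hyps)
      fix x y z i j k
      assume "{x, y, z} \<subseteq> W" "x \<noteq> y" "x \<noteq> z" "y \<noteq> z"
        "i \<in> c {x, z}" "j \<in> c {y, z}" "k \<in> c {x, y}" "i \<noteq> j" "k \<noteq> i" "k \<noteq> j"
      then show False
        by (intro less.prems(2)[of x y z i j k]) (auto simp: V)
    qed (use W card_V in auto)
    have pair: "card (c {u, w}) + card (c {v, w}) \<le> card K" if "w \<in> W" for w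
    proof (rule card_add_card_le_if_no_distinct_pair)
      fix i j assume ij: "i \<in> c {u, w}" "j \<in> c {v, w}"
      obtain k where "k \<in> c {u, v}" "k \<noteq> i" "k \<noteq> j"
        using ex_third_element[OF e3] uv(1) by blast
      then show "i = j"
        using less.prems(2)[of u v w i j k] that ij uv(2) W V by blast
    qed (use assms(1,2) cK in auto)
    have "(\<Sum>e\<in>[V]\<^bsup>2\<^esup>. card (c e)) = (\<Sum>e\<in>[W]\<^bsup>2\<^esup>. card (c e)) + card (c {u, v})
        + (\<Sum>w\<in>W. card (c {u, w}) + card (c {v, w}))"
      unfolding V using W by (simp add: sum_nsets_2_insert sum.distrib)
    \<comment> \<open>One \<open>card K\<close> for the pair \<open>{u, v}\<close> and one for each
      \<open>w\<close> give the \<open>card K * (card W + 1)\<close> of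
      \<open>f_step\<close>.\<close>
    also have "\<dots> \<le> f (card W) + card K + card W * card K"
      using IH card_mono[OF assms(1) cK, of "{u, v}"]
        sum_bounded_above[of W "\<lambda>w. card (c {u, w}) + card (c {v, w})" "card K", OF pair]
      by simp
    also have "\<dots> \<le> f (card V)"
      using f_step[of "card W"] by (simp add: card_V algebra_simps)
    finally show ?thesis .
  qed
qed

text \<open>The definition wants increasing indices, whereas colours arise in any order; the six
  orderings are treated separately.\<close>

lemma rainbow_triangle_freeD:
  assumes "rainbow_triangle_free V t G" and "{x, y, z} \<subseteq> V" and "x \<noteq> y" "x \<noteq> z" "y \<noteq> z"
    and "{i, j, k} \<subseteq> {1..t}" and "i \<noteq> j" "k \<noteq> i" "k \<noteq> j"
    and "{x, z} \<in> G i" "{y, z} \<in> G j" "{x, y} \<in> G k"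
  shows False
proof -
  have no: False if "1 \<le> i1" "i1 < i2" "i2 < i3" "i3 \<le> t" "E1 \<in> G i1" "E2 \<in> G i2" "E3 \<in> G i3"
    "{E1, E2, E3} = {{x, z}, {y, z}, {x, y}}" for i1 i2 i3 E1 E2 E3
  proof -
    have "[{x, y, z}]\<^bsup>2\<^esup> = {{x, z}, {y, z}, {x, y}}"
      using assms(3-5) by (auto simp: nsets_def card_2_iff doubleton_eq_iff)
    moreover have "{x, y, z} \<in> [V]\<^bsup>3\<^esup>"
      using assms(2-5) by (simp add: nsets_def)
    ultimately have "is_triangle V {E1, E2, E3}"
      unfolding is_triangle_def that(8) by metis
    then show False
      using assms(1) that unfolding rainbow_triangle_free_def by blast
  qed
  consider "i < j" "j < k" | "i < k" "k < j" | "j < i" "i < k" | "j < k" "k < i"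
    | "k < i" "i < j" | "k < j" "j < i"
    using assms(7-9) by linarith
  then show False
  proof cases
    case 1 then show False using no[of i j k "{x, z}" "{y, z}" "{x, y}"] assms(6,10-12) by auto
  next
    case 2 then show False using no[of i k j "{x, z}" "{x, y}" "{y, z}"] assms(6,10-12) by auto
  next
    case 3 then show False using no[of j i k "{y, z}" "{x, z}" "{x, y}"] assms(6,10-12) by auto
  next
    case 4 then show False using no[of j k i "{y, z}" "{x, y}" "{x, z}"] assms(6,10-12) by auto
  next
    case 5 then show False using no[of k i j "{x, y}" "{x, z}" "{y, z}"] assms(6,10-12) by auto
  next
    case 6 then show False using no[of k j i "{x, y}" "{y, z}" "{x, z}"] assms(6,10-12) by auto
  qed
qed

text \<open>Double counting of the pairs \<open>(i, e)\<close> with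
  \<open>e \<in> G i\<close>.\<close>

lemma sum_card_eq_sum_card_colours:
  assumes "finite I" "finite S" and "\<And>i. i \<in> I \<Longrightarrow> G i \<subseteq> S"
  shows "(\<Sum>i\<in>I. card (G i)) = (\<Sum>e\<in>S. card {i \<in> I. e \<in> G i})"
proof -
  have "(\<Sum>i\<in>I. card (G i)) = (\<Sum>i\<in>I. card {e \<in> S. e \<in> G i})"
    using assms(3) by (intro sum.cong refl arg_cong[of _ _ card]) auto
  also have "\<dots> = (\<Sum>e\<in>S. card {i \<in> I. e \<in> G i})"
    unfolding card_eq_sum sum.inter_filter[OF assms(1)] sum.inter_filter[OF assms(2)]
    by (rule sum.swap)
  finally show ?thesis .
qed

lemma sum_card_le_if_rainbow_triangle_free:
  fixes f :: "nat \<Rightarrow> nat"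
  assumes "2 \<le> t" and "finite V" and "\<And>i. i \<in> {1..t} \<Longrightarrow> G i \<subseteq> [V]\<^bsup>2\<^esup>"
    and "rainbow_triangle_free V t G"
    and "\<And>n. n * (n - 1) \<le> f n" and "\<And>n. f n + t * (n + 1) \<le> f (n + 2)"
  shows "(\<Sum>i = 1..t. card (G i)) \<le> f (card V)"
proof -
  have "(\<Sum>i = 1..t. card (G i)) = (\<Sum>e\<in>[V]\<^bsup>2\<^esup>. card {i \<in> {1..t}. e \<in> G i})"
    using assms(2,3) by (intro sum_card_eq_sum_card_colours) (auto simp: finite_imp_finite_nsets)
  also have "\<dots> \<le> f (card V)"
  proof (rule sum_card_colours_le[where K = "{1..t}"])
    fix x y z i j k
    assume *: "{x, y, z} \<subseteq> V" "x \<noteq> y" "x \<noteq> z" "y \<noteq> z" "i \<in> {i \<in> {1..t}. {x, z} \<in> G i}"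
      "j \<in> {i \<in> {1..t}. {y, z} \<in> G i}" "k \<in> {i \<in> {1..t}. {x, y} \<in> G i}"
      "i \<noteq> j" "k \<noteq> i" "k \<noteq> j"
    show False
      by (rule rainbow_triangle_freeD[OF assms(4) *(1-4) _ *(8-10)]) (use * in auto)
  qed (use assms in auto)
  finally show ?thesis .
qed

text \<open>This is \<open>f_ge\<close> for \<open>t \<ge> 4\<close>. Four times the quotient is
  \<open>n * n\<close> for even \<open>n\<close> and \<open>(n - 1) * (n + 1)\<close> for odd
  \<open>n\<close>.\<close>

lemma pred_mult_le_mult_square_div_4:
  fixes n t :: nat
  assumes "4 \<le> t"
  shows "n * (n - 1) \<le> t * (n\<^sup>2 div 4)"
proof -
  have "n * (n - 1) \<le> 4 * (n\<^sup>2 div 4)"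
  proof (cases "even n")
    case True
    then show ?thesis
      by (auto elim!: evenE simp: power2_eq_square)
  next
    case False
    then obtain m where "n = 2 * m + 1"
      by (rule oddE)
    then have "n\<^sup>2 = 4 * (m * m + m) + 1"
      by (simp add: power2_eq_square algebra_simps)
    then have "n\<^sup>2 div 4 = m * m + m"
      by simp
    then show ?thesis
      using \<open>n = 2 * m + 1\<close> by (simp add: algebra_simps)
  qed
  also have "\<dots> \<le> t * (n\<^sup>2 div 4)"
    using assms by (rule mult_le_mono1)
  finally show ?thesis .
qed

lemma square_add_2_div_4: "(n + 2)\<^sup>2 div 4 = n\<^sup>2 div 4 + (n + 1)" for n :: nat
proof -
  have "(n + 2)\<^sup>2 = n\<^sup>2 + (n + 1) * 4"
    by (simp add: power2_eq_square algebra_simps)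
  then show ?thesis
    by simp
qed

theorem theorem1p4:
  fixes V :: "'a set" and G :: "nat \<Rightarrow> 'a set set" and t n :: nat
  assumes "t \<ge> 3"
    and "finite V" and "card V = n"
    and "t = 3 \<Longrightarrow> n \<noteq> 2"
    and "\<And>i. i \<in> {1..t} \<Longrightarrow> G i \<subseteq> [V]\<^bsup>2\<^esup>"
    and "rainbow_triangle_free V t G"
  shows "(t = 3 \<and> card (G 1) + card (G 2) + card (G 3) \<le> n * (n - 1)) \<or>
         (t \<ge> 4 \<and> (\<Sum>i = 1..t. card (G i)) \<le> t * (n\<^sup>2 div 4))"
proof (cases "t = 3")
  case True
  \<comment> \<open>The induction passes through the exceptional case \<open>n = 2\<close>, where the optimum is 3.\<close>
  define f :: "nat \<Rightarrow> nat" where "f m = (if m = 2 then 3 else m * (m - 1))" for m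
  \<comment> \<open>Apart from \<open>m = 0\<close> and \<open>m = 2\<close> this amounts to
    \<open>1 \<le> m\<close>. At \<open>m = 0\<close> it needs the value 3 of \<open>f 2\<close>; at
    \<open>m = 2\<close> it is the equality \<open>3 + 9 = 12\<close>, so the excess is
    absorbed.\<close>
  have step: "f m + 3 * (m + 1) \<le> f (m + 2)" for m
    by (cases m) (auto simp: f_def algebra_simps)
  have "(\<Sum>i = 1..t. card (G i)) \<le> f (card V)"
    by (rule sum_card_le_if_rainbow_triangle_free)
      (use assms step True in \<open>auto simp: f_def\<close>)
  moreover have "(\<Sum>i = 1..t. card (G i)) = card (G 1) + card (G 2) + card (G 3)"
    by (simp add: True numeral_3_eq_3 numeral_2_eq_2)
  ultimately show ?thesis
    using assms(3,4) True by (simp add: f_def)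
next
  case False
  then have "4 \<le> t"
    using assms(1) by simp
  \<comment> \<open>Here \<open>f m\<close> is \<open>t * (m\<^sup>2 div 4)\<close>, and the step
    condition holds with equality by \<open>square_add_2_div_4\<close>.\<close>
  have "(\<Sum>i = 1..t. card (G i)) \<le> t * ((card V)\<^sup>2 div 4)"
    by (rule sum_card_le_if_rainbow_triangle_free)
      (use assms pred_mult_le_mult_square_div_4[OF \<open>4 \<le> t\<close>]
        in \<open>auto simp only: square_add_2_div_4 add_mult_distrib2\<close>)
  then show ?thesis
    using \<open>4 \<le> t\<close> assms(3) by simp
qed

end
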